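(* Let $k<0$. Then: 1. The function $g_k$ defined (for parameters $u\in\mathbb{R}$, $v>0$) by $$g_k(t)=\frac{1}{\sqrt{-k}}\,\operatorname{argcosh}\Big(\frac{1}{2v}\big[(u^2+v^2)e^{-\sqrt{-k}\,t}+e^{\sqrt{-k}\,t}\big]\Big)$$ satisfies the differential equation $$g_k''=\sqrt{-k}\,\big(1-(g_k')^2\big)\coth(\sqrt{-k}\,g_k).$$ 2. Let $0\le a<b$ and let $g:[a,b]\to\mathbb{R}$ be a smooth (or of class $\mathcal{C}^2$), positive-valued, distance-like function. For $a\le t_1<t_2\le b$ let $g_k^{t_1,t_2}$ denote the function $g_k$ with parameter values adjusted so that $g_k^{t_1,t_2}(t_1)=g(t_1)$ and $g_k^{t_1,t_2}(t_2)=g(t_2)$. (i) The differential inequality $$g''\ge\sqrt{-k}\,\big(1-(g')^2\big)\coth(\sqrt{-k}\,g)$$ is satisfied on $[a,b]$ if and only if $g\le g_k^{t_1,t_2}$ holds on $[t_1,t_2]$ for any $a\le t_1<t_2\le b$. (ii) The differential inequality $$g''\le\sqrt{-k}\,\big(1-(g')^2\big)\coth(\sqrt{-k}\,g)$$ is satisfied on $[a,b]$ if and only if $g\ge g_k^{t_1,t_2}$ holds on $[t_1,t_2]$ for any $a\le t_1<t_2\le b$.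
   Context: A non-negative function $g:[a,b]\to\mathbb{R}$ is called distance-like if it is nonexpanding, i.e. $|g(t_1)-g(t_2)|\le|t_1-t_2|$ for all $t_1,t_2\in[a,b]$, and moreover $|t_1-t_2|\le g(t_1)+g(t_2)$ for all $t_1,t_2\in[a,b]$. Here $\operatorname{argcosh}:[1,\infty)\to[0,\infty)$ is the inverse of $\cosh$. For $k<0$, the function $g_k$ with parameters $u\in\mathbb{R}$, $v>0$ is the distance from the point $(u,v)$ to the point $(0,e^{\sqrt{-k}\,t})$ of an arc-length parametrized geodesic in the upper half-plane model of the hyperbolic plane of curvature $k$. For a positive-valued distance-like function $g$ on $[a,b]$ and $a\le t_1<t_2\le b$, adjusting the parameters $u,v$ so that $g_k(t_1)=g(t_1)$ and $g_k(t_2)=g(t_2)$ is always possible when $k<0$. *)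

theory Defs
  imports "HOL-Analysis.Analysis"
begin

definition coth :: "real \<Rightarrow> real" where
  "coth x = cosh x / sinh x"

definition distance_like :: "(real \<Rightarrow> real) \<Rightarrow> real \<Rightarrow> real \<Rightarrow> bool" where
  "distance_like g a b \<longleftrightarrow>
     (\<forall>t\<in>{a..b}. 0 \<le> g t) \<and>
     (\<forall>t\<^sub>1\<in>{a..b}. \<forall>t\<^sub>2\<in>{a..b}. \<bar>g t\<^sub>1 - g t\<^sub>2\<bar> \<le> \<bar>t\<^sub>1 - t\<^sub>2\<bar>) \<and>
     (\<forall>t\<^sub>1\<in>{a..b}. \<forall>t\<^sub>2\<in>{a..b}. \<bar>t\<^sub>1 - t\<^sub>2\<bar> \<le> g t\<^sub>1 + g t\<^sub>2)"

text \<open>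
  Distance from the point \<open>(u, v)\<close> to the point \<open>(0, exp (sqrt (-k) * t))\<close> of a unit-speed
  geodesic in the upper half-plane of curvature \<open>k < 0\<close>. The argument of \<open>arcosh\<close> is at least
  \<open>1\<close> whenever \<open>v > 0\<close>. The value is \<open>0\<close> only where the two points coincide, which requires \<open>u = 0\<close>;
  then the function is \<open>\<bar>t - t\<^sub>0\<bar>\<close>, which is not differentiable at its zero \<open>t\<^sub>0\<close>.
\<close>

definition hyp_dist :: "real \<Rightarrow> real \<Rightarrow> real \<Rightarrow> real \<Rightarrow> real" where
  "hyp_dist k u v t =
     1 / sqrt (- k) *
     arcosh (1 / (2 * v) *
       ((u\<^sup>2 + v\<^sup>2) * exp (- (sqrt (- k) * t)) + exp (sqrt (- k) * t)))"

text \<open>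
  The comparison function, i.e. \<open>hyp_dist k u v\<close> with \<open>u\<close> and \<open>v > 0\<close> adjusted so that it agrees
  with \<open>g\<close> at \<open>t\<^sub>1\<close> and \<open>t\<^sub>2\<close>. The parameter \<open>u\<close> is determined only up to sign, but the function is
  unique (see \<open>comparison_ex1\<close> below), hence the description ranges over functions.
\<close>

definition comparison :: "real \<Rightarrow> (real \<Rightarrow> real) \<Rightarrow> real \<Rightarrow> real \<Rightarrow> real \<Rightarrow> real" where
  "comparison k g t\<^sub>1 t\<^sub>2 =
     (THE h. (\<exists>u v. v > 0 \<and> h = hyp_dist k u v) \<and> h t\<^sub>1 = g t\<^sub>1 \<and> h t\<^sub>2 = g t\<^sub>2)"

lemma hyp_dist_eq_iff:
  assumes "k < 0" "v > 0" "y \<ge> 0"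
  shows "hyp_dist k u v t = y \<longleftrightarrow>
    (u\<^sup>2 + v\<^sup>2) * exp (- (sqrt (- k) * t)) + exp (sqrt (- k) * t) = 2 * v * cosh (sqrt (- k) * y)"
proof -
  define s where "s = sqrt (- k)"
  have s: "s > 0" using assms by (simp add: s_def)
  define E where "E = exp (s * t)"
  have E: "E > 0" by (simp add: E_def)
  define X where "X = 1 / (2 * v) * ((u\<^sup>2 + v\<^sup>2) * exp (- (s * t)) + exp (s * t))"
  have X_E: "X = ((u\<^sup>2 + v\<^sup>2) / E + E) / (2 * v)"
    by (simp add: X_def E_def exp_minus divide_simps)
  have "2 * v * E \<le> u\<^sup>2 + v\<^sup>2 + E * E"
    using sum_squares_ge_zero[of u "v - E"] by (simp add: power2_eq_square algebra_simps)
  then have X1: "X \<ge> 1"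
    using assms E by (simp add: X_E field_simps)
  have "hyp_dist k u v t = y \<longleftrightarrow> arcosh X = s * y"
    using s by (simp add: hyp_dist_def X_def s_def field_simps)
  also have "\<dots> \<longleftrightarrow> X = cosh (s * y)"
    using X1 s assms by (metis arcosh_cosh_real cosh_arcosh_real mult_nonneg_nonneg less_imp_le)
  also have "\<dots> \<longleftrightarrow> (u\<^sup>2 + v\<^sup>2) * exp (- (s * t)) + exp (s * t) = 2 * v * cosh (s * y)"
    using assms by (auto simp: X_def field_simps)
  finally show ?thesis by (simp add: s_def)
qed

lemma comparison_ex1:
  assumes k: "k < 0" and g: "distance_like g a b" and t: "a \<le> t\<^sub>1" "t\<^sub>1 < t\<^sub>2" "t\<^sub>2 \<le> b"
  shows "\<exists>!h. (\<exists>u v. v > 0 \<and> h = hyp_dist k u v) \<and> h t\<^sub>1 = g t\<^sub>1 \<and> h t\<^sub>2 = g t\<^sub>2"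
proof -
  define s where "s = sqrt (- k)"
  have s: "s > 0" using k by (simp add: s_def)
  have mem: "t\<^sub>1 \<in> {a..b}" "t\<^sub>2 \<in> {a..b}" using t by auto
  define x where "x = s * g t\<^sub>1"
  define y where "y = s * g t\<^sub>2"
  define d where "d = s * (t\<^sub>2 - t\<^sub>1)"
  define P where "P = exp (s * t\<^sub>1)"
  define D where "D = exp d"
  have P: "P > 0" by (simp add: P_def)
  have g0: "g t\<^sub>1 \<ge> 0" "g t\<^sub>2 \<ge> 0" using g mem unfolding distance_like_def by auto
  have "\<bar>g t\<^sub>1 - g t\<^sub>2\<bar> \<le> \<bar>t\<^sub>1 - t\<^sub>2\<bar>" "\<bar>t\<^sub>1 - t\<^sub>2\<bar> \<le> g t\<^sub>1 + g t\<^sub>2"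
    using g mem unfolding distance_like_def by blast+
  then have g1: "\<bar>g t\<^sub>1 - g t\<^sub>2\<bar> \<le> t\<^sub>2 - t\<^sub>1" "t\<^sub>2 - t\<^sub>1 \<le> g t\<^sub>1 + g t\<^sub>2"
    using t by auto
  have x0: "x \<ge> 0" and y0: "y \<ge> 0" using s g0 by (auto simp: x_def y_def)
  have d0: "d > 0" using s t by (simp add: d_def)
  then have D: "D > 1" by (simp add: D_def)
  have "s * \<bar>g t\<^sub>1 - g t\<^sub>2\<bar> \<le> d" using s g1(1) by (simp add: d_def)
  moreover have "s * \<bar>g t\<^sub>1 - g t\<^sub>2\<bar> = \<bar>x - y\<bar>"
    using s by (simp add: x_def y_def abs_mult flip: right_diff_distrib)
  ultimately have tri1: "\<bar>x - y\<bar> \<le> d" by simp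
  have tri2: "d \<le> x + y"
    using s g1(2) by (simp add: d_def x_def y_def flip: distrib_left)
  define C where "C = cosh x"
  define K where "K = cosh y"
  have C0: "C > 0" "K > 0" by (simp_all add: C_def K_def)
  have Q: "exp (s * t\<^sub>2) = P * D"
    by (simp add: P_def D_def d_def algebra_simps flip: exp_add)
  have coshd: "cosh d = (D + 1 / D) / 2"
    by (simp add: cosh_field_def D_def exp_minus inverse_eq_divide)
  have "cosh (x - y) \<le> cosh d"
    using tri1 d0 cosh_real_nonneg_le_iff[of "\<bar>x - y\<bar>" d] by simp
  moreover have "cosh d \<le> cosh (x + y)"
    using tri2 d0 x0 y0 cosh_real_nonneg_le_iff[of d "x + y"] by simp
  ultimately have "\<bar>cosh d - C * K\<bar> \<le> sinh x * sinh y"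
    by (simp add: C_def K_def cosh_add cosh_diff abs_le_iff)
  then have "(cosh d - C * K)\<^sup>2 \<le> (sinh x * sinh y)\<^sup>2"
    by (metis abs_ge_zero power2_abs power_mono)
  also have "\<dots> = (C\<^sup>2 - 1) * (K\<^sup>2 - 1)"
    by (simp add: power_mult_distrib sinh_square_eq C_def K_def)
  finally have main: "(cosh d)\<^sup>2 - 1 \<le> 2 * C * K * cosh d - C\<^sup>2 - K\<^sup>2"
    by (simp add: power2_eq_square algebra_simps)
  have pos: "K * D - C > 0"
  proof -
    have "C \<le> cosh (y + d)"
      using tri1 x0 y0 d0 cosh_real_nonneg_le_iff[of x "y + d"] by (simp add: C_def)
    also have "cosh (y + d) = (exp (y + d) + exp (- y - d)) / 2"
      by (simp add: cosh_field_def)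
    also have "\<dots> < (exp (y + d) + exp (d - y)) / 2"
      using d0 by simp
    also have "\<dots> = K * D"
      by (simp add: K_def D_def cosh_field_def field_simps flip: exp_add)
    finally show ?thesis by simp
  qed
  \<comment> \<open>The two interpolation conditions form a linear system in \<open>u\<^sup>2 + v\<^sup>2\<close> and \<open>v\<close>.\<close>
  have sys: "hyp_dist k u v t\<^sub>1 = g t\<^sub>1 \<and> hyp_dist k u v t\<^sub>2 = g t\<^sub>2 \<longleftrightarrow>
      u\<^sup>2 + v\<^sup>2 + P\<^sup>2 = 2 * v * C * P \<and> u\<^sup>2 + v\<^sup>2 + P\<^sup>2 * D\<^sup>2 = 2 * v * K * P * D"
    if v: "v > 0" for u v
  proof -
    have "w * exp (- (s * t\<^sub>1)) + exp (s * t\<^sub>1) = 2 * v * C \<longleftrightarrow> w + P\<^sup>2 = 2 * v * C * P" for w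
      using P by (simp add: exp_minus P_def[symmetric] field_simps power2_eq_square)
    moreover have "w * exp (- (s * t\<^sub>2)) + exp (s * t\<^sub>2) = 2 * v * K \<longleftrightarrow>
        w + P\<^sup>2 * D\<^sup>2 = 2 * v * K * P * D" for w
      using P D by (simp add: exp_minus Q field_simps power2_eq_square)
    ultimately show ?thesis
      using hyp_dist_eq_iff[OF k v g0(1), of u t\<^sub>1] hyp_dist_eq_iff[OF k v g0(2), of u t\<^sub>2]
      by (simp add: s_def C_def K_def x_def y_def)
  qed
  have vsol: "v = P * (D\<^sup>2 - 1) / (2 * (K * D - C)) \<longleftrightarrow>
      2 * v * K * P * D - 2 * v * C * P = P\<^sup>2 * D\<^sup>2 - P\<^sup>2" for v
  proof -
    have "2 * v * K * P * D - 2 * v * C * P = P\<^sup>2 * D\<^sup>2 - P\<^sup>2 \<longleftrightarrow>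
        P * (v * (2 * (K * D - C))) = P * (P * (D\<^sup>2 - 1))"
      by (simp add: algebra_simps power2_eq_square)
    also have "\<dots> \<longleftrightarrow> v * (2 * (K * D - C)) = P * (D\<^sup>2 - 1)"
      using P by simp
    finally show ?thesis using pos by (simp add: eq_divide_eq)
  qed
  define v where "v = P * (D\<^sup>2 - 1) / (2 * (K * D - C))"
  have D2: "D\<^sup>2 > 1" using D by (simp add: power2_eq_square less_1_mult)
  have v0: "v > 0" using P D2 pos by (simp add: v_def)
  define W where "W = 2 * v * C * P - P\<^sup>2"
  have "v\<^sup>2 \<le> W"
  proof -
    define M where "M = K * D - C"
    have M: "M > 0" using pos by (simp add: M_def)
    have "D\<^sup>2 * ((cosh d)\<^sup>2 - 1) \<le> D\<^sup>2 * (2 * C * K * cosh d - C\<^sup>2 - K\<^sup>2)"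
      using main by (rule mult_left_mono) simp
    moreover have "D\<^sup>2 * ((cosh d)\<^sup>2 - 1) = (D\<^sup>2 - 1)\<^sup>2 / 4"
      using D by (simp add: coshd field_simps power2_eq_square)
    moreover have "D\<^sup>2 * (2 * C * K * cosh d - C\<^sup>2 - K\<^sup>2) = (D\<^sup>2 - 1) * C * M - M\<^sup>2"
      using D by (simp add: coshd M_def field_simps power2_eq_square)
    ultimately have *: "(D\<^sup>2 - 1)\<^sup>2 / 4 \<le> (D\<^sup>2 - 1) * C * M - M\<^sup>2" by simp
    have "W - v\<^sup>2 = P\<^sup>2 / M\<^sup>2 * ((D\<^sup>2 - 1) * C * M - M\<^sup>2 - (D\<^sup>2 - 1)\<^sup>2 / 4)"
      using M unfolding W_def v_def M_def[symmetric]
      by (simp add: field_simps power2_eq_square)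
    also have "\<dots> \<ge> 0" using * by (intro mult_nonneg_nonneg) auto
    finally show ?thesis by simp
  qed
  then have u: "(sqrt (W - v\<^sup>2))\<^sup>2 + v\<^sup>2 = W" by simp
  have "2 * v * K * P * D - 2 * v * C * P = P\<^sup>2 * D\<^sup>2 - P\<^sup>2"
    using vsol v_def by blast
  then have ex: "hyp_dist k (sqrt (W - v\<^sup>2)) v t\<^sub>1 = g t\<^sub>1 \<and> hyp_dist k (sqrt (W - v\<^sup>2)) v t\<^sub>2 = g t\<^sub>2"
    using sys[OF v0, of "sqrt (W - v\<^sup>2)"] u unfolding W_def by linarith
  have uniq: "hyp_dist k u' v' = hyp_dist k (sqrt (W - v\<^sup>2)) v"
    if v': "v' > 0" and h': "hyp_dist k u' v' t\<^sub>1 = g t\<^sub>1" "hyp_dist k u' v' t\<^sub>2 = g t\<^sub>2" for u' v'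
  proof -
    have eqs: "u'\<^sup>2 + v'\<^sup>2 + P\<^sup>2 = 2 * v' * C * P" "u'\<^sup>2 + v'\<^sup>2 + P\<^sup>2 * D\<^sup>2 = 2 * v' * K * P * D"
      using sys[OF v', of u'] h' by auto
    then have "2 * v' * K * P * D - 2 * v' * C * P = P\<^sup>2 * D\<^sup>2 - P\<^sup>2" by linarith
    then have "v' = v" unfolding v_def vsol .
    moreover from this have "u'\<^sup>2 + v'\<^sup>2 = W" using eqs by (simp add: W_def)
    ultimately show ?thesis using u by (intro ext) (simp add: hyp_dist_def)
  qed
  show ?thesis
    by (rule ex1I[of _ "hyp_dist k (sqrt (W - v\<^sup>2)) v"]) (use v0 ex uniq in blast)+
qed

end

theory Submission
  imports Defs
begin

text \<open>
  Put \<open>s = sqrt (- k)\<close>. The substitution \<open>F = cosh (s * g)\<close> linearises the problem: the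
  Riccati-type inequality for \<open>g\<close> becomes \<open>F'' \<ge> s\<^sup>2 * F\<close>, and the functions \<open>hyp_dist k u v\<close> become
  solutions of \<open>C'' = s\<^sup>2 * C\<close>. The comparison is then the maximum principle for
  \<open>w'' - s\<^sup>2 * w\<close>; for the converse, a strict failure of the inequality at one point persists on a
  short interval, where the maximum principle gives the strict opposite comparison.
\<close>

section \<open>Maximum principle for \<open>w'' - q * w\<close>\<close>

text \<open>Compactness gives a minimum, and the hypothesis on \<open>m\<close> lets it be taken in
  the open interval, where the second derivative test applies. The bound
  \<open>w c \<le> w m\<close> carries the sign of \<open>w\<close> at \<open>m\<close> over to
  \<open>c\<close>.\<close>

lemma interior_min_second_derivative_nonneg:
  fixes w w' w'' :: "real \<Rightarrow> real"
  assumes cont: "continuous_on {a..b} w"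
    and w': "\<And>t. a < t \<Longrightarrow> t < b \<Longrightarrow> (w has_real_derivative w' t) (at t)"
    and w'': "\<And>t. a < t \<Longrightarrow> t < b \<Longrightarrow> (w' has_real_derivative w'' t) (at t)"
    and m: "a < m" "m < b" "w m \<le> w a" "w m \<le> w b"
  obtains c where "a < c" "c < b" "w c \<le> w m" "w'' c \<ge> 0"
proof -
  obtain c0 where c0: "c0 \<in> {a..b}" "\<And>t. t \<in> {a..b} \<Longrightarrow> w c0 \<le> w t"
    using continuous_attains_inf[OF compact_Icc _ cont] m by auto
  \<comment> \<open>If the minimiser \<open>c0\<close> is an endpoint, then \<open>w m\<close> is at
    most \<open>w c0\<close>, so \<open>m\<close> is itself an interior minimiser.\<close>
  define c where "c = (if c0 \<in> {a<..<b} then c0 else m)"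
  have c: "a < c" "c < b" using m by (auto simp: c_def)
  have c_min: "w c \<le> w t" if "t \<in> {a..b}" for t
  proof (cases "c0 \<in> {a<..<b}")
    case False
    then have "c0 = a \<or> c0 = b" using c0(1) by auto
    then show ?thesis using c0(2)[OF that] m False unfolding c_def by auto
  qed (use c0(2)[OF that] in \<open>simp add: c_def\<close>)
  have "w c \<le> w m" using c_min m by simp
  moreover have "w'' c \<ge> 0"
  proof (rule ccontr)
    assume "\<not> w'' c \<ge> 0"
    have w'c: "w' c = 0"
    proof (rule DERIV_local_min[OF w'[OF c]])
      show "0 < min (c - a) (b - c)" using c by simp
      show "\<forall>y. \<bar>c - y\<bar> < min (c - a) (b - c) \<longrightarrow> w c \<le> w y"
        using c_min by (auto simp: abs_less_iff)
    qed
    \<comment> \<open>Since \<open>w' c = 0\<close>, a negative \<open>w'' c\<close> makes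
      \<open>w'\<close> negative just to the right of \<open>c\<close>, so \<open>w\<close> drops
      below its minimum there.\<close>
    obtain d where d: "d > 0" "\<And>h. h > 0 \<Longrightarrow> h < d \<Longrightarrow> w' (c + h) < w' c"
      using DERIV_neg_dec_right[OF w''[OF c]] \<open>\<not> w'' c \<ge> 0\<close> by force
    define e where "e = min d (b - c) / 2"
    have e: "e > 0" "e < d" "c + e < b" using d(1) c by (auto simp: e_def min_def field_simps)
    have "w (c + e) < w c"
    proof (rule DERIV_neg_imp_decreasing_open[of c "c + e" w])
      show "c < c + e" using e by simp
      show "\<exists>y. (w has_real_derivative y) (at t) \<and> y < 0" if "c < t" "t < c + e" for t
        using w'[of t] d(2)[of "t - c"] w'c that c e by (intro exI[of _ "w' t"]) auto
      show "continuous_on {c..c + e} w"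
        using cont by (rule continuous_on_subset) (use c e in auto)
    qed
    then show False using c_min[of "c + e"] c e by simp
  qed
  ultimately show ?thesis using that c by blast
qed

text \<open>Each direction looks at an interior minimum of a difference of \<open>F\<close> and
  \<open>H x y\<close>: there the second derivatives are ordered one way, while the values,
  multiplied by \<open>q > 0\<close>, force the other. \<open>F\<close> and \<open>H\<close> are
  kept abstract and of arbitrary sign, so the lemma also applies to their negatives.\<close>

lemma linear_comparison_iff:
  fixes F F' F'' :: "real \<Rightarrow> real" and H :: "real \<Rightarrow> real \<Rightarrow> real \<Rightarrow> real"
  assumes ab: "a < b" and q: "q > 0"
    and F': "\<And>t. t \<in> {a..b} \<Longrightarrow> (F has_real_derivative F' t) (at t within {a..b})"
    and F'': "\<And>t. t \<in> {a..b} \<Longrightarrow> (F' has_real_derivative F'' t) (at t within {a..b})"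
    and cont: "continuous_on {a..b} F''"
    and H: "\<And>x y. a \<le> x \<Longrightarrow> x < y \<Longrightarrow> y \<le> b \<Longrightarrow>
      \<exists>H'. (\<forall>t. (H x y has_real_derivative H' t) (at t)) \<and>
           (\<forall>t. (H' has_real_derivative q * H x y t) (at t))"
    and H_ends: "\<And>x y. a \<le> x \<Longrightarrow> x < y \<Longrightarrow> y \<le> b \<Longrightarrow> H x y x = F x \<and> H x y y = F y"
  shows "(\<forall>t\<in>{a..b}. q * F t \<le> F'' t) \<longleftrightarrow>
    (\<forall>x y. a \<le> x \<and> x < y \<and> y \<le> b \<longrightarrow> (\<forall>t\<in>{x..y}. F t \<le> H x y t))" (is "?L \<longleftrightarrow> ?R")
proof -
  have contF: "continuous_on {a..b} F"
    using F' by (rule DERIV_continuous_on)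
  have at_within: "at t within {a..b} = at t" if "a < t" "t < b" for t
    using that by (intro at_within_interior) auto
  show ?thesis
  proof
    assume L: ?L
    have "F m \<le> H x y m" if xy: "a \<le> x" "x < y" "y \<le> b" and m: "m \<in> {x..y}" for x y m
    proof (rule ccontr)
      assume neg: "\<not> F m \<le> H x y m"
      obtain H' where H': "\<And>t. (H x y has_real_derivative H' t) (at t)"
        and H'': "\<And>t. (H' has_real_derivative q * H x y t) (at t)"
        using H[OF xy] by blast
      have "x \<noteq> m" "y \<noteq> m" using neg H_ends[OF xy] by auto
      then have m': "x < m" "m < y" using m by auto
      \<comment> \<open>\<open>H x y - F\<close> vanishes at both ends and is negative at
        \<open>m\<close>. At its minimum \<open>c\<close> this gives
        \<open>F'' c \<le> q * H x y c < q * F c\<close>, against the assumed inequality.\<close>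
      obtain c where c: "x < c" "c < y" "H x y c - F c \<le> H x y m - F m" "q * H x y c - F'' c \<ge> 0"
      proof (rule interior_min_second_derivative_nonneg[of x y "\<lambda>t. H x y t - F t"
            "\<lambda>t. H' t - F' t" "\<lambda>t. q * H x y t - F'' t" m])
        show "continuous_on {x..y} (\<lambda>t. H x y t - F t)"
          using xy H' by (intro continuous_on_diff continuous_on_subset[OF contF] DERIV_continuous_on)
            (auto intro: has_field_derivative_at_within)
        show "((\<lambda>t. H x y t - F t) has_real_derivative H' t - F' t) (at t)" if "x < t" "t < y" for t
          using H' F'[of t] at_within[of t] that xy by (intro DERIV_diff) auto
        show "((\<lambda>t. H' t - F' t) has_real_derivative q * H x y t - F'' t) (at t)"
          if "x < t" "t < y" for t
          using H'' F''[of t] at_within[of t] that xy by (intro DERIV_diff) auto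
      qed (use m' neg H_ends[OF xy] in auto)
      have "q * F c \<le> F'' c" using L c xy by auto
      moreover have "q * H x y c < q * F c" using c neg q by simp
      ultimately show False using c by linarith
    qed
    then show ?R by blast
  next
    assume R: ?R
    show ?L
    proof (rule ccontr)
      assume "\<not> ?L"
      then obtain p where p: "p \<in> {a..b}" "F'' p - q * F p < 0" by force
      have "continuous_on {a..b} (\<lambda>t. F'' t - q * F t)"
        using cont contF by (intro continuous_intros)
      then have "\<forall>e>0. \<exists>d>0. \<forall>t\<in>{a..b}. dist t p < d \<longrightarrow>
          dist (F'' t - q * F t) (F'' p - q * F p) < e"
        using p(1) unfolding continuous_on_iff by blast
      \<comment> \<open>The tolerance is the size of the defect at \<open>p\<close>, so within
        distance \<open>d\<close> the defect cannot change sign.\<close>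
      moreover have "- (F'' p - q * F p) > 0" using p(2) by simp
      ultimately obtain d where d: "d > 0" "\<forall>t\<in>{a..b}. dist t p < d \<longrightarrow>
          dist (F'' t - q * F t) (F'' p - q * F p) < - (F'' p - q * F p)"
        by blast
      have neg: "F'' t < q * F t" if "t \<in> {a..b}" "\<bar>t - p\<bar> < d" for t
        using d(2)[rule_format, OF that(1)] that(2) by (auto simp: dist_real_def)
      \<comment> \<open>The neighbourhood is clipped to \<open>{a..b}\<close>, because
        \<open>p\<close> may be an endpoint; \<open>x < y\<close> holds in every case, and half the
        radius keeps the interval within distance \<open>d\<close> of \<open>p\<close>.\<close>
      define x where "x = max a (p - d / 2)"
      define y where "y = min b (p + d / 2)"
      have xy: "a \<le> x" "x < y" "y \<le> b" using ab p(1) d(1) by (auto simp: x_def y_def)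
      have xy_near: "\<bar>t - p\<bar> < d" if "x < t" "t < y" for t
        using that d(1) by (auto simp: x_def y_def abs_less_iff)
      obtain H' where H': "\<And>t. (H x y has_real_derivative H' t) (at t)"
        and H'': "\<And>t. (H' has_real_derivative q * H x y t) (at t)"
        using H[OF xy] by blast
      define m where "m = (x + y) / 2"
      have m: "x < m" "m < y" using xy by (auto simp: m_def)
      have Fm: "F m \<le> H x y m" using R xy m by auto
      \<comment> \<open>The roles are swapped: \<open>F - H x y\<close> vanishes at the ends and is
        at most 0 at the midpoint. Its minimum gives
        \<open>q * H x y c \<le> F'' c < q * F c\<close> although \<open>F c \<le> H x y c\<close>;
        the strictness comes from the choice of interval.\<close>
      obtain c where c: "x < c" "c < y" "F c - H x y c \<le> F m - H x y m" "F'' c - q * H x y c \<ge> 0"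
      proof (rule interior_min_second_derivative_nonneg[of x y "\<lambda>t. F t - H x y t"
            "\<lambda>t. F' t - H' t" "\<lambda>t. F'' t - q * H x y t" m])
        show "continuous_on {x..y} (\<lambda>t. F t - H x y t)"
          using xy H' by (intro continuous_on_diff continuous_on_subset[OF contF] DERIV_continuous_on)
            (auto intro: has_field_derivative_at_within)
        show "((\<lambda>t. F t - H x y t) has_real_derivative F' t - H' t) (at t)" if "x < t" "t < y" for t
          using H' F'[of t] at_within[of t] that xy by (intro DERIV_diff) auto
        show "((\<lambda>t. F' t - H' t) has_real_derivative F'' t - q * H x y t) (at t)"
          if "x < t" "t < y" for t
          using H'' F''[of t] at_within[of t] that xy by (intro DERIV_diff) auto
      qed (use m Fm H_ends[OF xy] in auto)
      have "F'' c < q * F c" using neg[of c] xy_near[of c] c xy by auto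
      moreover have "q * F c \<le> q * H x y c" using c Fm q by simp
      ultimately show False using c by linarith
    qed
  qed
qed

section \<open>The model functions \<open>hyp_dist k u v\<close> and their differential
  equation\<close>

context
  fixes k u v :: real
  assumes k: "k < 0" and v: "v > 0"
begin

text \<open>With \<open>E\<close> the growing exponential, multiplication by
  \<open>2 * v * E\<close> turns the bound into \<open>u^2 + (v - E)^2 >= 0\<close>. It is what
  allows \<open>cosh\<close> to undo \<open>arcosh\<close>.\<close>

lemma hyp_dist_arg_ge_1:
  "1 / (2 * v) * ((u\<^sup>2 + v\<^sup>2) * exp (- (sqrt (- k) * t)) + exp (sqrt (- k) * t)) \<ge> 1"
proof -
  define E where "E = exp (sqrt (- k) * t)"
  have E: "E > 0" by (simp add: E_def)
  have "2 * v * E \<le> u\<^sup>2 + v\<^sup>2 + E * E"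
    using sum_squares_ge_zero[of u "v - E"] by (simp add: power2_eq_square algebra_simps)
  then have "((u\<^sup>2 + v\<^sup>2) / E + E) / (2 * v) \<ge> 1"
    using v E by (simp add: field_simps)
  moreover have "1 / (2 * v) * ((u\<^sup>2 + v\<^sup>2) * exp (- (sqrt (- k) * t)) + exp (sqrt (- k) * t)) =
      ((u\<^sup>2 + v\<^sup>2) / E + E) / (2 * v)"
    by (simp add: E_def exp_minus divide_simps)
  ultimately show ?thesis by (simp only:)
qed

lemma hyp_dist_nonneg: "hyp_dist k u v t \<ge> 0"
  using k hyp_dist_arg_ge_1[of t] unfolding hyp_dist_def by simp

lemma cosh_hyp_dist:
  "cosh (sqrt (- k) * hyp_dist k u v t) =
    1 / (2 * v) * ((u\<^sup>2 + v\<^sup>2) * exp (- (sqrt (- k) * t)) + exp (sqrt (- k) * t))"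
  using k cosh_arcosh_real[OF hyp_dist_arg_ge_1[of t]] unfolding hyp_dist_def by simp

text \<open>The function is a linear combination of \<open>exp (s * t)\<close> and
  \<open>exp (- (s * t))\<close> with \<open>s = sqrt (- k)\<close>. Hence the linear equation holds
  at every \<open>t\<close>, including zeros of \<open>hyp_dist\<close>.\<close>

lemma cosh_hyp_dist_ode:
  obtains D where "\<And>t. ((\<lambda>t. cosh (sqrt (- k) * hyp_dist k u v t)) has_real_derivative D t) (at t)"
    and "\<And>t. (D has_real_derivative (- k) * cosh (sqrt (- k) * hyp_dist k u v t)) (at t)"
proof
  define s where "s = sqrt (- k)"
  have s2: "- k = s\<^sup>2" using k by (simp add: s_def)
  let ?D = "\<lambda>t. 1 / (2 * v) * (- s * (u\<^sup>2 + v\<^sup>2) * exp (- (s * t)) + s * exp (s * t))"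
  show "((\<lambda>t. cosh (sqrt (- k) * hyp_dist k u v t)) has_real_derivative ?D t) (at t)" for t
    unfolding cosh_hyp_dist unfolding s_def[symmetric] using v
    by (auto intro!: derivative_eq_intros simp: algebra_simps)
  show "(?D has_real_derivative (- k) * cosh (sqrt (- k) * hyp_dist k u v t)) (at t)" for t
    unfolding cosh_hyp_dist unfolding s_def[symmetric] unfolding s2 using v
    by (auto intro!: derivative_eq_intros simp: algebra_simps power2_eq_square)
qed

lemma hyp_dist_ode:
  assumes nz: "hyp_dist k u v t \<noteq> 0"
  shows "hyp_dist k u v field_differentiable at t"
    and "deriv (hyp_dist k u v) field_differentiable at t"
    and "deriv (deriv (hyp_dist k u v)) t =
      sqrt (- k) * (1 - (deriv (hyp_dist k u v) t)\<^sup>2) * coth (sqrt (- k) * hyp_dist k u v t)"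
proof -
  define s where "s = sqrt (- k)"
  define h where "h = hyp_dist k u v"
  have s: "s > 0" and s2: "- k = s\<^sup>2" using k by (simp_all add: s_def)
  obtain D where D: "\<And>x. ((\<lambda>x. cosh (s * h x)) has_real_derivative D x) (at x)"
    and D': "\<And>x. (D has_real_derivative s\<^sup>2 * cosh (s * h x)) (at x)"
    using cosh_hyp_dist_ode unfolding s_def[symmetric] h_def[symmetric] unfolding s2 by blast
  have h0: "h x \<ge> 0" for x using hyp_dist_nonneg by (simp add: h_def)
  \<comment> \<open>Passing through \<open>cosh\<close> and back writes \<open>h\<close> in terms of
    a function already known to be smooth; \<open>arcosh\<close> is differentiable where its
    argument exceeds 1, that is, where \<open>h\<close> is nonzero.\<close>
  have h_eq: "h = (\<lambda>x. arcosh (cosh (s * h x)) / s)"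
    using s h0 by (simp add: arcosh_cosh_real fun_eq_iff)
  have h': "(h has_real_derivative D x / (s * sinh (s * h x))) (at x)" if "h x \<noteq> 0" for x
  proof -
    have pos: "s * h x > 0" using s h0[of x] that by simp
    then have gt: "cosh (s * h x) > 1" using cosh_real_nonneg_less_iff[of 0 "s * h x"] by simp
    have "sqrt ((cosh (s * h x))\<^sup>2 - 1) = sinh (s * h x)"
      using pos by (simp add: cosh_square_eq)
    then have "((\<lambda>x. arcosh (cosh (s * h x)) / s) has_real_derivative
        D x / (s * sinh (s * h x))) (at x)"
      using DERIV_cdivide[OF DERIV_chain2[OF arcosh_real_has_field_derivative[OF gt] D[of x]], of s]
      by (simp add: mult.commute)
    then show ?thesis using h_eq by simp
  qed
  have nz': "h t \<noteq> 0" using nz by (simp add: h_def)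
  have pos: "sinh (s * h t) > 0" using s h0[of t] nz' by simp
  \<comment> \<open>Differentiating \<open>deriv h\<close> at \<open>t\<close> requires its formula
    on a whole neighbourhood. The set where \<open>h\<close> is nonzero is open, being the set where
    the continuous function \<open>cosh (s * h x)\<close> differs from 1.\<close>
  have "continuous_on UNIV (\<lambda>x. cosh (s * h x))"
    using D by (rule DERIV_continuous_on)
  then have "open {x. cosh (s * h x) \<noteq> 1}"
    by (intro open_Collect_neq) auto
  then have "open {x. h x \<noteq> 0}"
    using s h0 by (simp add: cosh_real_one_iff)
  then have "eventually (\<lambda>x. h x \<noteq> 0) (nhds t)"
    using nz' by (auto simp: eventually_nhds)
  then have ev: "eventually (\<lambda>x. deriv h x = D x / (s * sinh (s * h x))) (nhds t)"
    by eventually_elim (use h' in \<open>auto intro: DERIV_imp_deriv\<close>)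
  then have dh: "deriv h t = D t / (s * sinh (s * h t))" by (rule eventually_nhds_x_imp_x)
  have "((\<lambda>x. D x / (s * sinh (s * h x))) has_real_derivative
      s * (1 - (deriv h t)\<^sup>2) * coth (s * h t)) (at t)"
  proof -
    have "((\<lambda>x. D x / (s * sinh (s * h x))) has_real_derivative
        (s\<^sup>2 * cosh (s * h t) * (s * sinh (s * h t)) -
          D t * (s * (cosh (s * h t) * (s * deriv h t)))) /
        (s * sinh (s * h t))\<^sup>2) (at t)"
      using s pos h'[OF nz'] unfolding dh
      by (auto intro!: derivative_eq_intros D' simp: power2_eq_square)
    \<comment> \<open>Eliminating \<open>D t\<close> makes the quotient rule collapse to the factor
      \<open>1 - (deriv h t)^2\<close> times \<open>s * coth (s * h t)\<close>.\<close>
    moreover have "D t = s * sinh (s * h t) * deriv h t"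
      using s nz' dh by simp
    ultimately show ?thesis
      using s pos unfolding coth_def
      by (elim DERIV_cong) (simp add: divide_simps, simp add: algebra_simps power2_eq_square)
  qed
  then have h'': "(deriv h has_real_derivative s * (1 - (deriv h t)\<^sup>2) * coth (s * h t)) (at t)"
    using DERIV_cong_ev[OF refl ev refl] by simp
  show "hyp_dist k u v field_differentiable at t"
    using h'[OF nz'] unfolding h_def field_differentiable_def by blast
  show "deriv (hyp_dist k u v) field_differentiable at t"
    using h'' unfolding h_def field_differentiable_def by blast
  show "deriv (deriv (hyp_dist k u v)) t =
      sqrt (- k) * (1 - (deriv (hyp_dist k u v) t)\<^sup>2) * coth (sqrt (- k) * hyp_dist k u v t)"
    using DERIV_imp_deriv[OF h''] by (simp add: s_def h_def)
qed

end

section \<open>Transfer of the linear comparison to distance-like functions\<close>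

lemma comparison_props:
  assumes "k < 0" "distance_like g a b" "a \<le> x" "x < y" "y \<le> b"
  shows "\<exists>u v. v > 0 \<and> comparison k g x y = hyp_dist k u v"
    and "comparison k g x y x = g x" "comparison k g x y y = g y"
  using theI'[OF comparison_ex1[OF assms]] unfolding comparison_def[symmetric] by auto

text \<open>If \<open>r'\<close> and \<open>r''\<close> are the derivatives of a function with value
  \<open>r\<close>, then \<open>E\<close> is the second derivative of its image under
  \<open>cosh (s * _)\<close>. The linear defect is the Riccati defect times
  \<open>s * sinh (s * r)\<close>, which is positive because \<open>r > 0\<close>.\<close>

lemma riccati_iff_linear:
  fixes s r r' r'' :: real
  assumes "s > 0" "r > 0"
  defines "E \<equiv> s * r'' * sinh (s * r) + s\<^sup>2 * r'\<^sup>2 * cosh (s * r)"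
  shows "r'' \<ge> s * (1 - r'\<^sup>2) * coth (s * r) \<longleftrightarrow> s\<^sup>2 * cosh (s * r) \<le> E"
    and "r'' \<le> s * (1 - r'\<^sup>2) * coth (s * r) \<longleftrightarrow> E \<le> s\<^sup>2 * cosh (s * r)"
proof -
  have pos: "s * sinh (s * r) > 0" using assms by simp
  then have nz: "s \<noteq> 0" "sinh (s * r) \<noteq> 0" by auto
  have E: "E - s\<^sup>2 * cosh (s * r) =
      (s * sinh (s * r)) * (r'' - s * (1 - r'\<^sup>2) * coth (s * r))"
    using nz unfolding E_def coth_def by (simp add: divide_simps) (simp add: algebra_simps power2_eq_square)
  show "r'' \<ge> s * (1 - r'\<^sup>2) * coth (s * r) \<longleftrightarrow> s\<^sup>2 * cosh (s * r) \<le> E"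
    using E zero_le_mult_iff[of "s * sinh (s * r)" "r'' - s * (1 - r'\<^sup>2) * coth (s * r)"] pos
    by linarith
  show "r'' \<le> s * (1 - r'\<^sup>2) * coth (s * r) \<longleftrightarrow> E \<le> s\<^sup>2 * cosh (s * r)"
    using E mult_le_0_iff[of "s * sinh (s * r)" "r'' - s * (1 - r'\<^sup>2) * coth (s * r)"] pos
    by linarith
qed

text \<open>This is the linear comparison with \<open>q = s\<^sup>2\<close>, read back through
  \<open>cosh\<close>. Distance-likeness provides the comparison function for each pair of
  points.\<close>

lemma hyp_comparison:
  fixes g g' g'' :: "real \<Rightarrow> real"
  assumes k: "k < 0" and ab: "a < b"
    and g': "\<And>t. t \<in> {a..b} \<Longrightarrow> (g has_real_derivative g' t) (at t within {a..b})"
    and g'': "\<And>t. t \<in> {a..b} \<Longrightarrow> (g' has_real_derivative g'' t) (at t within {a..b})"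
    and cont: "continuous_on {a..b} g''"
    and pos: "\<And>t. t \<in> {a..b} \<Longrightarrow> 0 < g t"
    and dl: "distance_like g a b"
  shows "(\<forall>t\<in>{a..b}. g'' t \<ge> sqrt (- k) * (1 - (g' t)\<^sup>2) * coth (sqrt (- k) * g t)) \<longleftrightarrow>
      (\<forall>x y. a \<le> x \<and> x < y \<and> y \<le> b \<longrightarrow> (\<forall>t\<in>{x..y}. g t \<le> comparison k g x y t))" (is ?ge)
    and "(\<forall>t\<in>{a..b}. g'' t \<le> sqrt (- k) * (1 - (g' t)\<^sup>2) * coth (sqrt (- k) * g t)) \<longleftrightarrow>
      (\<forall>x y. a \<le> x \<and> x < y \<and> y \<le> b \<longrightarrow> (\<forall>t\<in>{x..y}. g t \<ge> comparison k g x y t))" (is ?le)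
proof -
  define s where "s = sqrt (- k)"
  have s: "s > 0" and s2: "- k = s\<^sup>2" using k by (simp_all add: s_def)
  define F where "F t = cosh (s * g t)" for t
  define F' where "F' t = s * g' t * sinh (s * g t)" for t
  define F'' where "F'' t = s * g'' t * sinh (s * g t) + s\<^sup>2 * (g' t)\<^sup>2 * cosh (s * g t)" for t
  define H where "H x y t = cosh (s * comparison k g x y t)" for x y t
  have F': "(F has_real_derivative F' t) (at t within {a..b})" if "t \<in> {a..b}" for t
    unfolding F_def F'_def by (auto intro!: derivative_eq_intros g'[OF that])
  have F'': "(F' has_real_derivative F'' t) (at t within {a..b})" if "t \<in> {a..b}" for t
    unfolding F'_def F''_def
    by (auto intro!: derivative_eq_intros g'[OF that] g''[OF that] simp: power2_eq_square)
  have "continuous_on {a..b} g" "continuous_on {a..b} g'"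
    using g' g'' by (blast intro: DERIV_continuous_on)+
  then have contF: "continuous_on {a..b} F''"
    unfolding F''_def using cont by (intro continuous_intros)
  have H: "\<exists>H'. (\<forall>t. (H x y has_real_derivative H' t) (at t)) \<and>
      (\<forall>t. (H' has_real_derivative s\<^sup>2 * H x y t) (at t))"
    if xy: "a \<le> x" "x < y" "y \<le> b" for x y
  proof -
    obtain u v where v: "v > 0" and c: "comparison k g x y = hyp_dist k u v"
      using comparison_props(1)[OF k dl xy] by blast
    show ?thesis
      using cosh_hyp_dist_ode[OF k v, of u] unfolding H_def c s_def[symmetric] unfolding s2 by metis
  qed
  have H_ends: "H x y x = F x \<and> H x y y = F y" if "a \<le> x" "x < y" "y \<le> b" for x y
    using comparison_props(2,3)[OF k dl that] by (simp add: H_def F_def)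
  \<comment> \<open>\<open>cosh\<close> is increasing on the nonnegative reals, where both arguments
    lie, so passing to \<open>F\<close> and \<open>H\<close> preserves order.\<close>
  have cosh_le: "(F t \<le> H x y t \<longleftrightarrow> g t \<le> comparison k g x y t) \<and>
      (H x y t \<le> F t \<longleftrightarrow> comparison k g x y t \<le> g t)"
    if xy: "a \<le> x" "x < y" "y \<le> b" and t: "t \<in> {x..y}" for x y t
  proof -
    obtain u v where v: "v > 0" and c: "comparison k g x y = hyp_dist k u v"
      using comparison_props(1)[OF k dl xy] by blast
    have "comparison k g x y t \<ge> 0" "g t \<ge> 0"
      using hyp_dist_nonneg[OF k v] c pos[of t] xy t by (auto simp: less_imp_le)
    then show ?thesis using s by (simp add: F_def H_def cosh_real_nonneg_le_iff)
  qed
  have "(\<forall>t\<in>{a..b}. s\<^sup>2 * F t \<le> F'' t) \<longleftrightarrow>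
      (\<forall>x y. a \<le> x \<and> x < y \<and> y \<le> b \<longrightarrow> (\<forall>t\<in>{x..y}. F t \<le> H x y t))"
    using s by (intro linear_comparison_iff[OF ab _ F' F'' contF H H_ends]) auto
  then show ?ge
    using riccati_iff_linear(1)[OF s pos] cosh_le
    by (simp add: F_def F''_def s_def)
  \<comment> \<open>The reverse inequality follows by negating \<open>F\<close> and
    \<open>H\<close>: the equation for \<open>H\<close> is linear, so \<open>- H x y\<close> solves
    it too.\<close>
  have "(\<forall>t\<in>{a..b}. s\<^sup>2 * (- F t) \<le> - F'' t) \<longleftrightarrow>
      (\<forall>x y. a \<le> x \<and> x < y \<and> y \<le> b \<longrightarrow> (\<forall>t\<in>{x..y}. - F t \<le> - H x y t))"
  proof (rule linear_comparison_iff[OF ab, where F' = "\<lambda>t. - F' t"])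
    show "\<exists>H'. (\<forall>t. ((\<lambda>t. - H x y t) has_real_derivative H' t) (at t)) \<and>
        (\<forall>t. (H' has_real_derivative s\<^sup>2 * - H x y t) (at t))"
      if xy: "a \<le> x" "x < y" "y \<le> b" for x y
    proof -
      obtain H' where "\<forall>t. (H x y has_real_derivative H' t) (at t)"
        "\<forall>t. (H' has_real_derivative s\<^sup>2 * H x y t) (at t)"
        using H[OF xy] by blast
      then show ?thesis by (intro exI[of _ "\<lambda>t. - H' t"]) (auto intro!: derivative_eq_intros)
    qed
  qed (use s H_ends in \<open>simp_all add: DERIV_minus F' F'' continuous_on_minus[OF contF]\<close>)
  then have "(\<forall>t\<in>{a..b}. F'' t \<le> s\<^sup>2 * F t) \<longleftrightarrow>
      (\<forall>x y. a \<le> x \<and> x < y \<and> y \<le> b \<longrightarrow> (\<forall>t\<in>{x..y}. H x y t \<le> F t))"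
    by simp
  then show ?le
    using riccati_iff_linear(2)[OF s pos] cosh_le
    by (simp add: F_def F''_def s_def)
qed

theorem proposition2p2:
  fixes k :: real
  assumes "k < 0"
  shows
    "(\<forall>u v t. 0 < v \<and> hyp_dist k u v t \<noteq> 0 \<longrightarrow>
        hyp_dist k u v field_differentiable at t \<and>
        deriv (hyp_dist k u v) field_differentiable at t \<and>
        deriv (deriv (hyp_dist k u v)) t =
          sqrt (- k) * (1 - (deriv (hyp_dist k u v) t)\<^sup>2) * coth (sqrt (- k) * hyp_dist k u v t))
     \<and>
     (\<forall>(a::real) (b::real) (g::real \<Rightarrow> real) (g'::real \<Rightarrow> real) (g''::real \<Rightarrow> real).
        0 \<le> a \<and> a < b \<and>
        (\<forall>t\<in>{a..b}. (g has_real_derivative g' t) (at t within {a..b})) \<and>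
        (\<forall>t\<in>{a..b}. (g' has_real_derivative g'' t) (at t within {a..b})) \<and>
        continuous_on {a..b} g'' \<and>
        (\<forall>t\<in>{a..b}. 0 < g t) \<and>
        distance_like g a b \<longrightarrow>
        ((\<forall>t\<in>{a..b}. g'' t \<ge> sqrt (- k) * (1 - (g' t)\<^sup>2) * coth (sqrt (- k) * g t)) \<longleftrightarrow>
         (\<forall>t\<^sub>1 t\<^sub>2. a \<le> t\<^sub>1 \<and> t\<^sub>1 < t\<^sub>2 \<and> t\<^sub>2 \<le> b \<longrightarrow>
            (\<forall>t\<in>{t\<^sub>1..t\<^sub>2}. g t \<le> comparison k g t\<^sub>1 t\<^sub>2 t)))
        \<and>
        ((\<forall>t\<in>{a..b}. g'' t \<le> sqrt (- k) * (1 - (g' t)\<^sup>2) * coth (sqrt (- k) * g t)) \<longleftrightarrow>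
         (\<forall>t\<^sub>1 t\<^sub>2. a \<le> t\<^sub>1 \<and> t\<^sub>1 < t\<^sub>2 \<and> t\<^sub>2 \<le> b \<longrightarrow>
            (\<forall>t\<in>{t\<^sub>1..t\<^sub>2}. g t \<ge> comparison k g t\<^sub>1 t\<^sub>2 t))))"
proof (rule conjI; intro allI impI; elim conjE)
  fix u v t :: real
  assume "0 < v" "hyp_dist k u v t \<noteq> 0"
  then show "hyp_dist k u v field_differentiable at t \<and>
      deriv (hyp_dist k u v) field_differentiable at t \<and>
      deriv (deriv (hyp_dist k u v)) t =
        sqrt (- k) * (1 - (deriv (hyp_dist k u v) t)\<^sup>2) * coth (sqrt (- k) * hyp_dist k u v t)"
    by (intro conjI hyp_dist_ode[OF assms])
next
  fix a b :: real and g g' g'' :: "real \<Rightarrow> real"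
  assume "a < b" and "\<forall>t\<in>{a..b}. (g has_real_derivative g' t) (at t within {a..b})"
    and "\<forall>t\<in>{a..b}. (g' has_real_derivative g'' t) (at t within {a..b})"
    and "continuous_on {a..b} g''" and "\<forall>t\<in>{a..b}. 0 < g t" and "distance_like g a b"
  then show "((\<forall>t\<in>{a..b}. g'' t \<ge> sqrt (- k) * (1 - (g' t)\<^sup>2) * coth (sqrt (- k) * g t)) \<longleftrightarrow>
         (\<forall>t\<^sub>1 t\<^sub>2. a \<le> t\<^sub>1 \<and> t\<^sub>1 < t\<^sub>2 \<and> t\<^sub>2 \<le> b \<longrightarrow>
            (\<forall>t\<in>{t\<^sub>1..t\<^sub>2}. g t \<le> comparison k g t\<^sub>1 t\<^sub>2 t)))
        \<and>
        ((\<forall>t\<in>{a..b}. g'' t \<le> sqrt (- k) * (1 - (g' t)\<^sup>2) * coth (sqrt (- k) * g t)) \<longleftrightarrow>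
         (\<forall>t\<^sub>1 t\<^sub>2. a \<le> t\<^sub>1 \<and> t\<^sub>1 < t\<^sub>2 \<and> t\<^sub>2 \<le> b \<longrightarrow>
            (\<forall>t\<in>{t\<^sub>1..t\<^sub>2}. g t \<ge> comparison k g t\<^sub>1 t\<^sub>2 t)))"
    by (intro conjI hyp_comparison[OF assms, of a b g g' g'']) simp_all
qed

end
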